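(* Let $\mathsf{G}=(N,B,w)$ be a strongly connected weighted directed graph with $N=\{1,\dots,n\}$, such that detailed balance holds for some $\mathbf{C}=\mathrm{diag}\{c_1,\dots,c_n\}$ with all $c_i>0$, i.e. $c_iw_{ij}=c_jw_{ji}$ for all $i,j\in N$. Consider the network system dynamics on $\mathsf{G}$ governed by $$\dot x_i=\sum_{j:(j,i)\in B}w_{ij}\,\phi(x_j,x_i),\qquad i\in N,$$ where $\phi(\cdot,\cdot)$ is Lipschitz continuous, $\phi(a,b)$ is negative if $a<b$, zero iff $a=b$, positive if $a>b$, and $|\phi(a,b)|$ is increasing if $|a-b|$ is increasing. Define the new state $\boldsymbol q:=\mathbf{C}\boldsymbol x$, and consider the sum-separable function $$E(\boldsymbol q):=\sum_{i\in N}c_iH(c_i^{-1}q_i),$$ where $H:\mathbb{R}\to\mathbb{R}$ is any $C^2$ function, and set $h(z):=\frac{\mathrm{d}H(z)}{\mathrm{d}z}$. If $H$ is strictly convex, then the system can be represented as $$\dot{\boldsymbol q}=-\mathbf{K}(\boldsymbol q)\nabla E(\boldsymbol q),$$ where $\mathbf{K}(\cdot)$ is defined as the irreducible and symmetric Laplace matrix having components (with $x_i=c_i^{-1}q_i$) $$[\mathbf{K}]_{ij}:=\begin{cases}-c_iw_{ij}\dfrac{\phi(x_j,x_i)}{h(x_j)-h(x_i)} & \text{if } j\neq i,\\[2mm] -\sum_{k=1,\,k\neq i}^n[\mathbf{K}]_{ik} & \text{if } i=j.\end{cases}$$ The function $E$ is a Lyapunov function establishing asymptotic stability of the equilibrium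 point $x_\infty\mathbf{1}$, with equilibrium value the weighted arithmetic mean $$x_\infty=\frac{\sum_{i\in N}c_ix_i(0)}{\sum_{i\in N}c_i}.$$
   Context: Graph: $N=\{1,\dots,n\}$ is the set of nodes; $B\subseteq N\times N$ is the set of branches, whose elements are ordered pairs $(j,i)$ denoting an edge from node $j$ to node $i$; $w:B\to\mathbb{R}_{>0}$ is a weighting function with $w_{ij}:=w((j,i))$ if $(j,i)\in B$ and $w_{ij}=0$ otherwise. The Laplace matrix $\mathbf{L}$ associated to $\mathsf{G}$ is defined by $[\mathbf{L}]_{ij}=-w_{ij}$ for $i\neq j$ and $[\mathbf{L}]_{ii}=\sum_jw_{ij}$ (sum over $j\neq i$); so a Laplace matrix has nonpositive off-diagonal entries and zero row sums. For a strongly connected graph, $\boldsymbol c=(c_1,\dots,c_n)$ denotes the positive left eigenvector of $\mathbf{L}$ for its unique zero eigenvalue, and $\mathbf{C}=\mathrm{diag}\{c_1,\dots,c_n\}$. Detailed balance, $c_iw_{ij}=c_jw_{ji}$ for all $i,j\in N$, is equivalent to $\mathbf{C}\mathbf{L}=\mathbf{L}^\top\mathbf{C}$. Conventions: $\boldsymbol x=(x_1,\dots,x_n)$ is the state vector, $\phi$ is a real-valued function of two real arguments, $\nabla E$ is the gradient with respect to $\boldsymbol q$, and $\mathbf{1}$ is the all-ones vector. At $x_j=x_i$ the quotient $\frac{\phi(x_j,x_i)}{h(x_j)-h(x_i)}$ is understood as its limit as $x_j\to x_i$. The point $x_\infty\mathbf{1}$ is the equilibrium belonging to the initial condition $\boldsymbol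 x(0)$, and asymptotic stability is understood for initial conditions in the set where $\sum_iq_i=\sum_ic_ix_i$ has the fixed value $\sum_ic_ix_i(0)$.
   Formalization: K(q) is shown to be a symmetric Laplace matrix only where the limits of the quotient needed at q (edges with x_j = x_i) exist as real numbers, and irreducible only if these limits are nonzero; otherwise the claim about K fails, e.g. φ(a,b)=(a−b)³ near a=b with H=z²/2 gives K=0 at consensus. *)

theory Defs
  imports "HOL-Analysis.Analysis"
begin

text \<open>
  The node set is the finite type \<open>'n\<close>. A branch \<open>(j, i)\<close> is an edge from \<open>j\<close> to \<open>i\<close>, and its
  weight is written with the indices swapped: \<open>weight B w i j\<close> is the weight of \<open>(j, i)\<close>.
\<close>

definition strongly_connected :: "('n \<times> 'n) set \<Rightarrow> bool" where
  "strongly_connected B \<longleftrightarrow> (\<forall>i j. (i, j) \<in> B\<^sup>*)"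

definition weight :: "('n \<times> 'n) set \<Rightarrow> ('n \<times> 'n \<Rightarrow> real) \<Rightarrow> 'n \<Rightarrow> 'n \<Rightarrow> real" where
  "weight B w i j = (if (j, i) \<in> B then w (j, i) else 0)"

definition laplace_matrix ::
    "('n::finite \<times> 'n) set \<Rightarrow> ('n \<times> 'n \<Rightarrow> real) \<Rightarrow> real ^ 'n ^ 'n" where
  "laplace_matrix B w =
     (\<chi> i j. if i = j then (\<Sum>k\<in>UNIV - {i}. weight B w i k) else - weight B w i j)"

definition is_laplace_matrix :: "real ^ 'n ^ 'n \<Rightarrow> bool" where
  "is_laplace_matrix A \<longleftrightarrow> (\<exists>B w. (\<forall>e\<in>B. 0 < w e) \<and> A = laplace_matrix B w)"

text \<open>
  A matrix is reducible if some simultaneous permutation of rows and columns brings it to block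
  triangular form, that is, if a nonempty proper set \<open>S\<close> of indices has a zero block
  \<open>S \<times> (- S)\<close>. With this convention every 1-by-1 matrix is irreducible.
\<close>

definition irreducible_matrix :: "real ^ 'n ^ 'n \<Rightarrow> bool" where
  "irreducible_matrix A \<longleftrightarrow>
     \<not> (\<exists>S. S \<noteq> {} \<and> S \<noteq> UNIV \<and> (\<forall>i\<in>S. \<forall>j\<in>- S. A $ i $ j = 0))"

definition diag_matrix :: "real ^ 'n \<Rightarrow> real ^ 'n ^ 'n" where
  "diag_matrix c = (\<chi> i j. if i = j then c $ i else 0)"

definition strictly_convex :: "(real \<Rightarrow> real) \<Rightarrow> bool" where
  "strictly_convex H \<longleftrightarrow>
     (\<forall>x y t. x \<noteq> y \<and> 0 < t \<and> t < 1 \<longrightarrow> H ((1 - t) * x + t * y) < (1 - t) * H x + t * H y)"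

text \<open>Meaningful only where the function is differentiable.\<close>

definition gradient :: "('a::real_inner \<Rightarrow> real) \<Rightarrow> 'a \<Rightarrow> 'a" where
  "gradient V q = (THE D. GDERIV V q :> D)"

definition network_field ::
    "('n::finite \<times> 'n) set \<Rightarrow> ('n \<times> 'n \<Rightarrow> real) \<Rightarrow> (real \<Rightarrow> real \<Rightarrow> real)
      \<Rightarrow> real ^ 'n \<Rightarrow> real ^ 'n" where
  "network_field B w \<phi> x = (\<chi> i. \<Sum>j\<in>{j. (j, i) \<in> B}. weight B w i j * \<phi> (x $ j) (x $ i))"

definition energy :: "(real \<Rightarrow> real) \<Rightarrow> real ^ 'n \<Rightarrow> real ^ 'n \<Rightarrow> real" where
  "energy H c q = (\<Sum>i\<in>UNIV. c $ i * H (inverse (c $ i) * q $ i))"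

text \<open>
  At \<open>a = b\<close> the quotient is the limit as the first argument tends to \<open>b\<close>; \<open>Lim\<close> is
  unspecified if that limit does not exist as a real number.
\<close>

definition flow_quotient :: "(real \<Rightarrow> real \<Rightarrow> real) \<Rightarrow> (real \<Rightarrow> real) \<Rightarrow> real \<Rightarrow> real \<Rightarrow> real" where
  "flow_quotient \<phi> h a b =
     (if a = b then Lim (at b) (\<lambda>s. \<phi> s b / (h s - h b)) else \<phi> a b / (h a - h b))"

definition flow_quotient_exists :: "(real \<Rightarrow> real \<Rightarrow> real) \<Rightarrow> (real \<Rightarrow> real) \<Rightarrow> real \<Rightarrow> real \<Rightarrow> bool" where
  "flow_quotient_exists \<phi> h a b \<longleftrightarrow>
     (a = b \<longrightarrow> (\<exists>l. ((\<lambda>s. \<phi> s b / (h s - h b)) \<longlongrightarrow> l) (at b)))"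

definition K_offdiag ::
    "('n \<times> 'n) set \<Rightarrow> ('n \<times> 'n \<Rightarrow> real) \<Rightarrow> real ^ 'n \<Rightarrow> (real \<Rightarrow> real \<Rightarrow> real)
      \<Rightarrow> (real \<Rightarrow> real) \<Rightarrow> real ^ 'n \<Rightarrow> 'n \<Rightarrow> 'n \<Rightarrow> real" where
  "K_offdiag B w c \<phi> h q i j =
     - (c $ i * weight B w i j * flow_quotient \<phi> h (inverse (c $ j) * q $ j) (inverse (c $ i) * q $ i))"

definition K_matrix ::
    "('n::finite \<times> 'n) set \<Rightarrow> ('n \<times> 'n \<Rightarrow> real) \<Rightarrow> real ^ 'n \<Rightarrow> (real \<Rightarrow> real \<Rightarrow> real)
      \<Rightarrow> (real \<Rightarrow> real) \<Rightarrow> real ^ 'n \<Rightarrow> real ^ 'n ^ 'n" where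
  "K_matrix B w c \<phi> h q =
     (\<chi> i j. if i = j then - (\<Sum>k\<in>UNIV - {i}. K_offdiag B w c \<phi> h q i k)
             else K_offdiag B w c \<phi> h q i j)"

definition gradient_field ::
    "('n::finite \<times> 'n) set \<Rightarrow> ('n \<times> 'n \<Rightarrow> real) \<Rightarrow> real ^ 'n \<Rightarrow> (real \<Rightarrow> real \<Rightarrow> real)
      \<Rightarrow> (real \<Rightarrow> real) \<Rightarrow> (real \<Rightarrow> real) \<Rightarrow> real ^ 'n \<Rightarrow> real ^ 'n" where
  "gradient_field B w c \<phi> H h q = - (K_matrix B w c \<phi> h q *v gradient (energy H c) q)"

definition solves_on ::
    "real set \<Rightarrow> ('a::real_normed_vector \<Rightarrow> 'a) \<Rightarrow> (real \<Rightarrow> 'a) \<Rightarrow> bool" where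
  "solves_on T F x \<longleftrightarrow> (\<forall>t\<in>T. (x has_vector_derivative F (x t)) (at t within T))"

text \<open>
  Strict Lyapunov function for the equilibrium \<open>p\<close> of the flow of \<open>F\<close> restricted to the
  positively invariant set \<open>M\<close>.
\<close>

definition lyapunov_function_on ::
    "'a::real_inner set \<Rightarrow> ('a \<Rightarrow> 'a) \<Rightarrow> 'a \<Rightarrow> ('a \<Rightarrow> real) \<Rightarrow> bool" where
  "lyapunov_function_on M F p V \<longleftrightarrow>
     p \<in> M \<and> F p = 0 \<and>
     (\<forall>x. solves_on {0..} F x \<and> x 0 \<in> M \<longrightarrow> (\<forall>t\<ge>0. x t \<in> M)) \<and>
     (\<forall>q\<in>M. V differentiable (at q)) \<and>
     (\<forall>q\<in>M. q \<noteq> p \<longrightarrow> V p < V q) \<and>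
     (\<forall>q\<in>M. q \<noteq> p \<longrightarrow> gradient V q \<bullet> F q < 0)"

text \<open>Stability and attractivity for all initial conditions in \<open>M\<close>.\<close>

definition asymptotically_stable_on ::
    "'a::real_normed_vector set \<Rightarrow> ('a \<Rightarrow> 'a) \<Rightarrow> 'a \<Rightarrow> bool" where
  "asymptotically_stable_on M F p \<longleftrightarrow>
     p \<in> M \<and> F p = 0 \<and>
     (\<forall>\<epsilon>>0. \<exists>\<delta>>0. \<forall>x. solves_on {0..} F x \<and> x 0 \<in> M \<and> dist (x 0) p < \<delta>
        \<longrightarrow> (\<forall>t\<ge>0. dist (x t) p < \<epsilon>)) \<and>
     (\<forall>x. solves_on {0..} F x \<and> x 0 \<in> M \<longrightarrow> (x \<longlongrightarrow> p) at_top)"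

definition weighted_mean :: "real ^ 'n \<Rightarrow> real ^ 'n \<Rightarrow> real" where
  "weighted_mean c x = (\<Sum>i\<in>UNIV. c $ i * x $ i) / (\<Sum>i\<in>UNIV. c $ i)"

end

theory Submission
  imports Defs
begin

text \<open>
  Continuity and the monotonicity of \<open>\<bar>\<phi>\<bar>\<close> force \<open>\<phi> b a = - \<phi> a b\<close>, which together with
  detailed balance makes the edge flows \<open>c\<^sub>i w\<^sub>i\<^sub>j \<phi> x\<^sub>j x\<^sub>i\<close> antisymmetric. Summation by parts over the
  edges then shows, for every strictly increasing \<open>g\<close>, that \<open>\<Sum>\<^sub>i c\<^sub>i g(x\<^sub>i) x\<^sub>i'\<close> is negative off the
  consensus states. With \<open>g = h\<close> this is the decay of \<open>E\<close>. Solutions are shown to converge with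
  the quadratic choice \<open>g z = z - x\<^sub>\<infinity>\<close>, whose Lyapunov function \<open>\<Sum>\<^sub>i c\<^sub>i (x\<^sub>i - x\<^sub>\<infinity>)\<^sup>2\<close> is proper for trivial
  reasons; this needs no growth assumption on \<open>H\<close>.
\<close>

subsection \<open>Strictly convex functions\<close>

text \<open>Convexity alone gives the weak tangent inequality. It is applied at the midpoint of
  \<open>x\<close> and \<open>y\<close>, where strict convexity supplies the missing
  strictness.\<close>

lemma strictly_convex_above_tangent:
  assumes "strictly_convex H" and deriv: "\<And>z. (H has_real_derivative h z) (at z)" and "x \<noteq> y"
  shows "H x + h x * (y - x) < H y"
proof -
  have "convex_on UNIV H"
  proof (rule convex_onI)
    fix t x y :: real
    assume "0 < t" "t < 1"
    then show "H ((1 - t) *\<^sub>R x + t *\<^sub>R y) \<le> (1 - t) * H x + t * H y"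
      using assms(1)[unfolded strictly_convex_def, rule_format, of x y t]
      by (cases "x = y") (auto simp: left_diff_distrib)
  qed simp
  then have "h x * ((x + y) / 2 - x) \<le> H ((x + y) / 2) - H x"
    by (rule convex_on_imp_above_tangent) (use deriv in \<open>auto intro: connected_UNIV\<close>)
  moreover have "H ((1 - 1/2) * x + 1/2 * y) < (1 - 1/2) * H x + 1/2 * H y"
    using assms(1)[unfolded strictly_convex_def, rule_format, of x y "1/2"] assms(3) by simp
  moreover have "(1 - 1/2) * x + 1/2 * y = (x + y) / 2"
    by (simp add: field_simps)
  ultimately show ?thesis
    by (simp add: field_simps)
qed

text \<open>Adding the tangent inequalities at \<open>x\<close> and at \<open>y\<close> gives a
  positive product of increments.\<close>

lemma strictly_convex_deriv_strict_mono:
  assumes "strictly_convex H" and "\<And>z. (H has_real_derivative h z) (at z)"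
  shows "strict_mono h"
proof (rule strict_monoI)
  fix x y :: real
  assume "x < y"
  then have "H x + h x * (y - x) < H y" "H y + h y * (x - y) < H x"
    using strictly_convex_above_tangent[OF assms] by auto
  then have "0 < (h y - h x) * (y - x)"
    by (simp add: algebra_simps)
  then show "h x < h y"
    using \<open>x < y\<close> by (simp add: zero_less_mult_iff)
qed

subsection \<open>Lyapunov's direct method\<close>

text \<open>Mean value theorem on \<open>{s..t}\<close>. Below, \<open>d = 0\<close> yields
  monotonicity along solutions and a positive \<open>d\<close> yields a forced drop.\<close>

lemma deriv_bound_imp_decay:
  fixes v v' :: "real \<Rightarrow> real"
  assumes deriv: "\<And>t. 0 \<le> t \<Longrightarrow> (v has_real_derivative v' t) (at t within {0..})"
    and bound: "\<And>t. 0 \<le> t \<Longrightarrow> v' t \<le> - d"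
    and "0 \<le> s" "s \<le> t"
  shows "v t \<le> v s - d * (t - s)"
proof (cases "s = t")
  case False
  have "\<exists>r\<in>{s<..<t}. v t - v s = v' r * (t - s)"
  proof (rule mvt_simple)
    fix r assume "s \<le> r" "r \<le> t"
    then show "(v has_derivative (*) (v' r)) (at r within {s..t})"
      using deriv[of r] \<open>0 \<le> s\<close> unfolding has_field_derivative_def
      by (auto elim: has_derivative_subset)
  qed (use False \<open>s \<le> t\<close> in auto)
  then obtain r where r: "r \<in> {s<..<t}" "v t - v s = v' r * (t - s)"
    by blast
  then have "v' r * (t - s) \<le> - d * (t - s)"
    using bound[of r] assms(3,4) by (intro mult_right_mono) auto
  then show ?thesis
    using r by simp
qed simp

text \<open>\<open>W\<close> is the derivative of \<open>V\<close> along solutions, written as a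
  function of the state. The quadratic lower bound makes sublevel sets of \<open>V\<close> in the
  closed set \<open>M\<close> compact, so \<open>W\<close> attains a maximum on them away from
  \<open>p\<close>.\<close>

lemma strict_lyapunov_imp_asymptotically_stable_on:
  fixes F :: "'a::euclidean_space \<Rightarrow> 'a" and V W :: "'a \<Rightarrow> real"
  assumes "closed M" "p \<in> M" "F p = 0"
    and invariant: "\<And>x t. solves_on {0..} F x \<Longrightarrow> x 0 \<in> M \<Longrightarrow> 0 \<le> t \<Longrightarrow> x t \<in> M"
    and V_deriv: "\<And>x t. solves_on {0..} F x \<Longrightarrow> 0 \<le> t \<Longrightarrow>
      ((\<lambda>s. V (x s)) has_real_derivative W (x t)) (at t within {0..})"
    and cont_V: "continuous_on M V" and cont_W: "continuous_on M W"
    and "V p = 0" "W p = 0"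
    and W_neg: "\<And>q. q \<in> M \<Longrightarrow> q \<noteq> p \<Longrightarrow> W q < 0"
    and "0 < \<alpha>" and coercive: "\<And>q. q \<in> M \<Longrightarrow> \<alpha> * (dist q p)\<^sup>2 \<le> V q"
  shows "asymptotically_stable_on M F p"
proof -
  have W_nonpos: "W q \<le> 0" if "q \<in> M" for q
    using W_neg[OF that] \<open>W p = 0\<close> by (cases "q = p") auto
  have decreasing: "V (x t) \<le> V (x s)"
    if "solves_on {0..} F x" "x 0 \<in> M" "0 \<le> s" "s \<le> t" for x s t
  proof -
    have "V (x t) \<le> V (x s) - 0 * (t - s)"
      by (rule deriv_bound_imp_decay[where v = "\<lambda>t. V (x t)" and v' = "\<lambda>t. W (x t)"])
        (use V_deriv[OF that(1)] W_nonpos[OF invariant[OF that(1,2)]] that(3,4) in simp_all)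
    then show ?thesis
      by simp
  qed
  \<comment> \<open>Coercivity places a sublevel set of \<open>V\<close> inside each ball around
    \<open>p\<close>. Both stability and attractivity reduce to bounding \<open>V\<close>.\<close>
  have close: "dist q p < \<epsilon>" if "q \<in> M" "V q < \<alpha> * \<epsilon>\<^sup>2" "0 < \<epsilon>" for q \<epsilon>
  proof -
    have "(dist q p)\<^sup>2 < \<epsilon>\<^sup>2"
      using coercive[OF that(1)] that(2) \<open>0 < \<alpha>\<close> by (smt (verit) mult_less_cancel_left_pos)
    then show ?thesis
      using \<open>0 < \<epsilon>\<close> by (simp add: power2_less_imp_less)
  qed
  have stable: "\<exists>\<delta>>0. \<forall>x. solves_on {0..} F x \<and> x 0 \<in> M \<and> dist (x 0) p < \<delta>
      \<longrightarrow> (\<forall>t\<ge>0. dist (x t) p < \<epsilon>)" if "0 < \<epsilon>" for \<epsilon>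
  proof -
    have "0 < \<alpha> * \<epsilon>\<^sup>2"
      using that \<open>0 < \<alpha>\<close> by simp
    then obtain \<delta> where "0 < \<delta>" and \<delta>: "\<And>q. q \<in> M \<Longrightarrow> dist q p < \<delta> \<Longrightarrow> dist (V q) (V p) < \<alpha> * \<epsilon>\<^sup>2"
      using cont_V \<open>p \<in> M\<close> unfolding continuous_on_iff by metis
    have "dist (x t) p < \<epsilon>"
      if x: "solves_on {0..} F x" "x 0 \<in> M" "dist (x 0) p < \<delta>" "0 \<le> t" for x t
    proof (rule close)
      show "V (x t) < \<alpha> * \<epsilon>\<^sup>2"
        using decreasing[OF x(1,2), of 0 t] \<delta>[OF x(2,3)] x(4) \<open>V p = 0\<close> by (simp add: dist_real_def)
    qed (use invariant x \<open>0 < \<epsilon>\<close> in auto)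
    then show ?thesis
      using \<open>0 < \<delta>\<close> by blast
  qed
  have attractive: "(x \<longlongrightarrow> p) at_top" if x: "solves_on {0..} F x" "x 0 \<in> M" for x
  proof (rule tendstoI)
    fix \<epsilon> :: real
    assume "0 < \<epsilon>"
    define \<eta> where "\<eta> = \<alpha> * \<epsilon>\<^sup>2"
    have "0 < \<eta>"
      using \<open>0 < \<epsilon>\<close> \<open>0 < \<alpha>\<close> by (simp add: \<eta>_def)
    have "\<exists>T\<ge>0. V (x T) < \<eta>"
    proof (rule ccontr)
      assume "\<not> ?thesis"
      then have large: "\<eta> \<le> V (x t)" if "0 \<le> t" for t
        using that by force
      \<comment> \<open>If \<open>V\<close> stayed above \<open>\<eta>\<close>, the solution would
        remain in this compact shell. It excludes \<open>p\<close> because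
        \<open>V p = 0 < \<eta>\<close>, so the maximum of \<open>W\<close> on it is
        negative.\<close>
      define S where "S = M \<inter> V -` {\<eta>..V (x 0)}"
      have x_in_S: "x t \<in> S" if "0 \<le> t" for t
        using large[OF that] decreasing[OF x, of 0 t] invariant[OF x that] that by (simp add: S_def)
      have "closed S"
        unfolding S_def using cont_V \<open>closed M\<close> by (intro continuous_closed_preimage) auto
      moreover have "bounded S"
      proof (rule boundedI)
        fix q assume "q \<in> S"
        then have "\<alpha> * (dist q p)\<^sup>2 \<le> V (x 0)"
          using coercive[of q] by (auto simp: S_def)
        then have "(dist q p)\<^sup>2 \<le> V (x 0) / \<alpha>"
          using \<open>0 < \<alpha>\<close> by (simp add: field_simps)
        then have "dist q p \<le> sqrt (V (x 0) / \<alpha>)"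
          by (simp add: real_le_rsqrt)
        then show "norm q \<le> norm p + sqrt (V (x 0) / \<alpha>)"
          using norm_triangle_ineq2[of q p] by (simp add: dist_norm)
      qed
      ultimately have "compact S"
        by (simp add: compact_eq_bounded_closed)
      moreover have "continuous_on S W"
        using cont_W by (rule continuous_on_subset) (auto simp: S_def)
      ultimately obtain q where "q \<in> S" and max: "\<And>q'. q' \<in> S \<Longrightarrow> W q' \<le> W q"
        using continuous_attains_sup[of S W] x_in_S[of 0] by auto
      have "W q < 0"
        using \<open>q \<in> S\<close> \<open>0 < \<eta>\<close> \<open>V p = 0\<close> by (intro W_neg) (auto simp: S_def)
      \<comment> \<open>At this time a decay at the constant rate \<open>- W q\<close> has used up
        all of \<open>V (x 0)\<close>.\<close>
      define T where "T = V (x 0) / (- W q)"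
      have "0 \<le> T"
        using large[of 0] \<open>0 < \<eta>\<close> \<open>W q < 0\<close> unfolding T_def by (intro divide_nonneg_pos) auto
      have "V (x T) \<le> V (x 0) - (- W q) * (T - 0)"
        using max[OF x_in_S] \<open>0 \<le> T\<close>
        by (intro deriv_bound_imp_decay[where v = "\<lambda>t. V (x t)" and v' = "\<lambda>t. W (x t)", OF V_deriv[OF x(1)]]) auto
      also have "\<dots> = 0"
        using \<open>W q < 0\<close> by (simp add: T_def)
      finally show False
        using large[OF \<open>0 \<le> T\<close>] \<open>0 < \<eta>\<close> by simp
    qed
    then obtain T where "0 \<le> T" "V (x T) < \<eta>"
      by blast
    then have "dist (x t) p < \<epsilon>" if "T \<le> t" for t
      using decreasing[OF x \<open>0 \<le> T\<close> that] invariant[OF x, of t] that \<open>0 < \<epsilon>\<close>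
      by (intro close) (auto simp: \<eta>_def)
    then show "\<forall>\<^sub>F t in at_top. dist (x t) p < \<epsilon>"
      by (auto simp: eventually_at_top_linorder)
  qed
  show ?thesis
    unfolding asymptotically_stable_on_def using assms(2,3) stable attractive by blast
qed

subsection \<open>The energy and its gradient\<close>

lemma gradient_eqI:
  assumes "GDERIV V q :> D"
  shows "gradient V q = D"
  unfolding gradient_def
proof (rule the_equality)
  fix D' assume "GDERIV V q :> D'"
  then have "(\<lambda>y. inner y D') = (\<lambda>y. inner y D)"
    using assms unfolding gderiv_def by (blast intro: has_derivative_unique)
  then show "D' = D"
    by (metis inner_commute vector_eq_rdot)
qed fact

lemma diag_matrix_mult_nth [simp]: "(diag_matrix c *v x) $ i = c $ i * x $ i"
  by (simp add: diag_matrix_def matrix_vector_mult_def if_distrib[where f = "\<lambda>a. a * _"] cong: if_cong)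

text \<open>The weight \<open>c $ i\<close> cancels the chain rule factor
  \<open>inverse (c $ i)\<close>, which leaves \<open>h\<close> of the original state as the
  gradient.\<close>

lemma GDERIV_energy:
  fixes c :: "real ^ 'n::finite"
  assumes c_pos: "\<And>i. 0 < c $ i" and deriv: "\<And>z. (H has_real_derivative h z) (at z)"
  shows "GDERIV (energy H c) q :> (\<chi> i. h (inverse (c $ i) * q $ i))"
proof -
  have "((\<lambda>q. H (inverse (c $ i) * q $ i)) has_derivative
      (\<lambda>y. h (inverse (c $ i) * q $ i) * (inverse (c $ i) * y $ i))) (at q)" for i
    using deriv[unfolded has_field_derivative_def]
    by (rule has_derivative_compose[rotated])
      (intro has_derivative_mult_right bounded_linear_imp_has_derivative bounded_linear_vec_nth)
  then have "(energy H c has_derivative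
      (\<lambda>y. \<Sum>i\<in>UNIV. c $ i * (h (inverse (c $ i) * q $ i) * (inverse (c $ i) * y $ i)))) (at q)"
    unfolding energy_def by (intro has_derivative_sum has_derivative_mult_right)
  moreover have "c $ i * (h z * (inverse (c $ i) * y)) = y * h z" for i y z
    using c_pos[of i] by simp
  ultimately show ?thesis
    unfolding gderiv_def inner_vec_def by simp
qed

text \<open>Jensen's inequality by tangents: summing the tangent inequalities at \<open>z\<close>
  with weights \<open>c $ i\<close>, the linear terms cancel by the mass constraint, and a component
  different from \<open>z\<close> makes the sum strict.\<close>

lemma energy_strict_min:
  fixes c :: "real ^ 'n::finite"
  assumes c_pos: "\<And>i. 0 < c $ i"
    and H: "strictly_convex H" "\<And>z. (H has_real_derivative h z) (at z)"
    and mass: "(\<Sum>i\<in>UNIV. c $ i * x $ i) = (\<Sum>i\<in>UNIV. c $ i * z)"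
    and "x \<noteq> (\<chi> i. z)"
  shows "energy H c (diag_matrix c *v (\<chi> i. z)) < energy H c (diag_matrix c *v x)"
proof -
  have [simp]: "inverse (c $ i) * (c $ i * y) = y" for i y
    using c_pos[of i] by simp
  obtain k where k: "x $ k \<noteq> z"
    using \<open>x \<noteq> _\<close> by (auto simp: vec_eq_iff)
  have "(\<Sum>i\<in>UNIV. c $ i * (H z + h z * (x $ i - z)))
      = (\<Sum>i\<in>UNIV. c $ i * H z) + h z * ((\<Sum>i\<in>UNIV. c $ i * x $ i) - (\<Sum>i\<in>UNIV. c $ i * z))"
    by (simp add: algebra_simps sum.distrib sum_subtractf sum_distrib_left)
  then have "(\<Sum>i\<in>UNIV. c $ i * H z) = (\<Sum>i\<in>UNIV. c $ i * (H z + h z * (x $ i - z)))"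
    using mass by simp
  also have "\<dots> < (\<Sum>i\<in>UNIV. c $ i * H (x $ i))"
  proof (rule sum_strict_mono_ex1)
    show "\<forall>i\<in>UNIV. c $ i * (H z + h z * (x $ i - z)) \<le> c $ i * H (x $ i)"
    proof
      fix i
      have "H z + h z * (x $ i - z) \<le> H (x $ i)"
        using strictly_convex_above_tangent[OF H, of z "x $ i"] by (cases "x $ i = z") auto
      then show "c $ i * (H z + h z * (x $ i - z)) \<le> c $ i * H (x $ i)"
        using c_pos[of i] by simp
    qed
    show "\<exists>i\<in>UNIV. c $ i * (H z + h z * (x $ i - z)) < c $ i * H (x $ i)"
      using strictly_convex_above_tangent[OF H, of z "x $ k"] k c_pos[of k]
      by (intro bexI[of _ k]) auto
  qed simp
  finally show ?thesis
    by (simp add: energy_def)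
qed

lemma weighted_mean_mass:
  fixes c :: "real ^ 'n::finite"
  assumes "\<And>i. 0 < c $ i"
  shows "(\<Sum>i\<in>UNIV. c $ i * weighted_mean c x) = (\<Sum>i\<in>UNIV. c $ i * x $ i)"
proof -
  have "0 < (\<Sum>i\<in>UNIV. c $ i)"
    using assms by (intro sum_pos) auto
  then have "(\<Sum>i\<in>UNIV. c $ i) * weighted_mean c x = (\<Sum>i\<in>UNIV. c $ i * x $ i)"
    by (simp add: weighted_mean_def)
  then show ?thesis
    by (simp add: sum_distrib_right)
qed

text \<open>A path from outside \<open>S\<close> to inside must enter \<open>S\<close> along some
  edge. This serves both strict dissipation, with \<open>S\<close> a level set of the state, and
  irreducibility of K.\<close>

lemma strongly_connected_crossing_edge:
  assumes "strongly_connected B" and "S \<noteq> {}" "S \<noteq> UNIV"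
  obtains i j where "(j, i) \<in> B" "i \<in> S" "j \<notin> S"
proof -
  obtain i j where "i \<in> S" "j \<notin> S"
    using assms(2,3) by blast
  have "(j, i) \<in> B\<^sup>*"
    using assms(1) by (simp add: strongly_connected_def)
  then have "j \<notin> S \<Longrightarrow> i \<in> S \<Longrightarrow> \<exists>(k, l) \<in> B. k \<notin> S \<and> l \<in> S"
    by (induction rule: rtrancl_induct) auto
  then show thesis
    using \<open>i \<in> S\<close> \<open>j \<notin> S\<close> that by blast
qed

subsection \<open>Networks with detailed balance\<close>

locale balanced_network =
  fixes B :: "('n::finite \<times> 'n) set"
    and w :: "'n \<times> 'n \<Rightarrow> real"
    and c :: "real ^ 'n"
    and \<phi> :: "real \<Rightarrow> real \<Rightarrow> real"
  assumes weights_pos: "\<And>e. e \<in> B \<Longrightarrow> 0 < w e"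
    and connected: "strongly_connected B"
    and c_pos: "\<And>i. 0 < c $ i"
    and detailed_balance: "\<And>i j. c $ i * weight B w i j = c $ j * weight B w j i"
    and phi_cont: "continuous_on UNIV (\<lambda>(a, b). \<phi> a b)"
    and phi_neg: "\<And>a b. a < b \<Longrightarrow> \<phi> a b < 0"
    and phi_zero: "\<And>a b. \<phi> a b = 0 \<longleftrightarrow> a = b"
    and phi_pos: "\<And>a b. a > b \<Longrightarrow> \<phi> a b > 0"
    and phi_increasing: "\<And>a b a' b'. \<bar>a - b\<bar> < \<bar>a' - b'\<bar> \<Longrightarrow> \<bar>\<phi> a b\<bar> < \<bar>\<phi> a' b'\<bar>"
begin

lemma c_nonzero [simp]: "c $ i \<noteq> 0"
  using c_pos[of i] by simp

lemma weight_nonneg: "0 \<le> weight B w i j"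
  using weights_pos by (auto simp: weight_def intro: less_imp_le)

lemma continuous_on_phi:
  assumes "continuous_on S f" "continuous_on S g"
  shows "continuous_on S (\<lambda>s. \<phi> (f s) (g s))"
  using continuous_on_compose2[OF phi_cont continuous_on_Pair[OF assms]] by simp

text \<open>Monotonicity compares only pairs at different distances, so it says nothing directly
  about \<open>(a, b)\<close> and \<open>(b, a)\<close>. Replacing \<open>b\<close> by some
  \<open>s > b\<close> in one of them makes it applicable, and \<open>s\<close> tending to
  \<open>b\<close> from the right gives both inequalities by continuity.\<close>

lemma phi_antisym: "\<phi> b a = - \<phi> a b"
proof -
  have less: "\<phi> b a = - \<phi> a b" if "a < b" for a b
  proof (rule antisym)
    have "((\<lambda>s. - \<phi> a s) \<longlongrightarrow> - \<phi> a b) (at_right b)"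
      by (intro tendsto_minus continuous_on_tendsto_compose[OF continuous_on_phi[where S = UNIV]])
        (auto intro!: continuous_intros tendsto_eq_intros)
    moreover have "\<phi> b a \<le> - \<phi> a s" if "b < s" for s
      using phi_increasing[of b a a s] \<open>a < b\<close> that phi_pos[of a b] phi_neg[of a s] by auto
    then have "\<forall>\<^sub>F s in at_right b. \<phi> b a \<le> - \<phi> a s"
      by (simp add: eventually_at_filter)
    ultimately show "\<phi> b a \<le> - \<phi> a b"
      by (rule tendsto_lowerbound) simp
    have "((\<lambda>s. \<phi> s a) \<longlongrightarrow> \<phi> b a) (at_right b)"
      by (intro continuous_on_tendsto_compose[OF continuous_on_phi[where S = UNIV]])
        (auto intro!: continuous_intros tendsto_eq_intros)
    moreover have "- \<phi> a b \<le> \<phi> s a" if "b < s" for s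
      using phi_increasing[of a b s a] \<open>a < b\<close> that phi_pos[of a s] phi_neg[of a b] by auto
    then have "\<forall>\<^sub>F s in at_right b. - \<phi> a b \<le> \<phi> s a"
      by (simp add: eventually_at_filter)
    ultimately show "- \<phi> a b \<le> \<phi> b a"
      by (rule tendsto_lowerbound) simp
  qed
  consider "a < b" | "b < a" | "a = b"
    by linarith
  then show ?thesis
    using less[of a b] less[of b a] phi_zero[of a a] by cases auto
qed

lemma network_field_nth: "network_field B w \<phi> x $ i = (\<Sum>j\<in>UNIV. weight B w i j * \<phi> (x $ j) (x $ i))"
proof -
  have "(\<Sum>j\<in>{j. (j, i) \<in> B}. weight B w i j * \<phi> (x $ j) (x $ i))
      = (\<Sum>j\<in>UNIV. weight B w i j * \<phi> (x $ j) (x $ i))"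
    by (rule sum.mono_neutral_left) (auto simp: weight_def)
  then show ?thesis
    by (simp add: network_field_def)
qed

text \<open>The edge flows are antisymmetric, so averaging the double sum with its index-swapped
  copy turns \<open>g\<close> into half a difference along edges. Choosing \<open>g\<close> constant
  gives conservation of mass, a strictly increasing \<open>g\<close> gives dissipation.\<close>

lemma summation_by_parts:
  "(\<Sum>i\<in>UNIV. g (x $ i) * (c $ i * network_field B w \<phi> x $ i))
    = - (\<Sum>i\<in>UNIV. \<Sum>j\<in>UNIV.
         c $ i * weight B w i j * (\<phi> (x $ j) (x $ i) * (g (x $ j) - g (x $ i)))) / 2"
proof -
  define f where "f i j = c $ i * weight B w i j * \<phi> (x $ j) (x $ i)" for i j
  have f_antisym: "f j i = - f i j" for i j
    using detailed_balance[of i j] phi_antisym[of "x $ i" "x $ j"] by (simp add: f_def)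
  have lhs: "(\<Sum>i\<in>UNIV. g (x $ i) * (c $ i * network_field B w \<phi> x $ i))
      = (\<Sum>i\<in>UNIV. \<Sum>j\<in>UNIV. f i j * g (x $ i))" (is "?L = ?A")
    by (simp add: network_field_nth f_def sum_distrib_left mult_ac)
  have "?A = (\<Sum>j\<in>UNIV. \<Sum>i\<in>UNIV. f i j * g (x $ i))"
    by (rule sum.swap)
  also have "\<dots> = - (\<Sum>i\<in>UNIV. \<Sum>j\<in>UNIV. f i j * g (x $ j))"
    by (subst f_antisym) (simp add: sum_negf)
  finally have "2 * ?A = - (\<Sum>i\<in>UNIV. \<Sum>j\<in>UNIV. f i j * (g (x $ j) - g (x $ i)))"
    by (simp add: right_diff_distrib sum_subtractf)
  then show ?thesis
    unfolding lhs by (simp add: f_def mult.assoc)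
qed

lemma flow_conserved: "(\<Sum>i\<in>UNIV. c $ i * network_field B w \<phi> x $ i) = 0"
  using summation_by_parts[of "\<lambda>_. 1" x] by simp

text \<open>\<phi> and the increment of \<open>g\<close> have the same sign, so no edge contributes
  negatively to the double sum. Off consensus, the level set of some component is a proper nonempty
  set, and an edge entering it contributes strictly.\<close>

lemma dissipation_neg:
  assumes g: "strict_mono g" and "\<nexists>z. x = (\<chi> i. z)"
  shows "(\<Sum>i\<in>UNIV. g (x $ i) * (c $ i * network_field B w \<phi> x $ i)) < 0"
proof -
  define d where "d i j = \<phi> (x $ j) (x $ i) * (g (x $ j) - g (x $ i))" for i j
  have d_pos: "0 < d i j" if "x $ i \<noteq> x $ j" for i j
    using that phi_neg[of "x $ j" "x $ i"] phi_pos[of "x $ i" "x $ j"] strict_monoD[OF g]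
    unfolding d_def by (cases "x $ i" "x $ j" rule: linorder_cases)
      (auto intro: mult_neg_neg mult_pos_pos)
  have d_nonneg: "0 \<le> d i j" for i j
    using d_pos[of i j] by (cases "x $ i = x $ j") (auto simp: d_def)
  have term_nonneg: "0 \<le> c $ i * weight B w i j * d i j" for i j
    using d_nonneg c_pos[of i] weight_nonneg by simp
  obtain k where k: "x \<noteq> (\<chi> i. x $ k)"
    using assms(2) by blast
  then have "{i. x $ i = x $ k} \<noteq> {}" "{i. x $ i = x $ k} \<noteq> UNIV"
    by (auto simp: vec_eq_iff)
  from strongly_connected_crossing_edge[OF connected this]
  obtain i j where ij: "(j, i) \<in> B" "x $ i = x $ k" "x $ j \<noteq> x $ k"
    by blast
  have "0 < c $ i * weight B w i j * d i j"
    using ij d_pos[of i j] c_pos[of i] weights_pos[of "(j, i)"] by (simp add: weight_def)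
  then have "0 < (\<Sum>j\<in>UNIV. c $ i * weight B w i j * d i j)"
    using term_nonneg by (intro sum_pos2[where i = j]) auto
  then have "0 < (\<Sum>i\<in>UNIV. \<Sum>j\<in>UNIV. c $ i * weight B w i j * d i j)"
    using term_nonneg by - (rule sum_pos2[of UNIV i], auto intro: sum_nonneg)
  then show ?thesis
    unfolding summation_by_parts d_def by simp
qed

section \<open>Conservation of mass and convergence to the weighted mean\<close>

lemma mass_invariant:
  assumes x: "solves_on {0..} (network_field B w \<phi>) x" and "0 \<le> t"
  shows "(\<Sum>i\<in>UNIV. c $ i * x t $ i) = (\<Sum>i\<in>UNIV. c $ i * x 0 $ i)"
proof -
  have "((\<lambda>t. \<Sum>i\<in>UNIV. c $ i * x t $ i) has_vector_derivative 0) (at s within {0..})" if "0 \<le> s" for s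
  proof -
    have "((\<lambda>t. x t $ i) has_vector_derivative network_field B w \<phi> (x s) $ i) (at s within {0..})" for i
      using x that unfolding solves_on_def
      by (auto intro: bounded_linear.has_vector_derivative[OF bounded_linear_vec_nth])
    then have "((\<lambda>t. \<Sum>i\<in>UNIV. c $ i * x t $ i) has_vector_derivative
        (\<Sum>i\<in>UNIV. c $ i * network_field B w \<phi> (x s) $ i)) (at s within {0..})"
      by (intro has_vector_derivative_sum has_vector_derivative_mult_right)
    then show ?thesis
      by (simp add: flow_conserved)
  qed
  then obtain k where "\<And>s. s \<in> {0..} \<Longrightarrow> (\<Sum>i\<in>UNIV. c $ i * x s $ i) = k"
    using has_vector_derivative_zero_constant[of "{0..}" "\<lambda>t. \<Sum>i\<in>UNIV. c $ i * x t $ i"] by auto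
  then show ?thesis
    using \<open>0 \<le> t\<close> by simp
qed

lemma network_field_consensus: "network_field B w \<phi> (\<chi> i. z) = 0"
  by (simp add: vec_eq_iff network_field_nth phi_zero[THEN iffD2, OF refl])

text \<open>Since the total weight is positive, the mass fixes the consensus value. Strict
  dissipation therefore holds at every state of the mass hyperplane except the equilibrium.\<close>

lemma consensus_on_mass:
  assumes "(\<Sum>i\<in>UNIV. c $ i * x $ i) = (\<Sum>i\<in>UNIV. c $ i * x0 $ i)"
    and "x \<noteq> (\<chi> i. weighted_mean c x0)"
  shows "\<nexists>z. x = (\<chi> i. z)"
proof
  assume "\<exists>z. x = (\<chi> i. z)"
  then obtain z where z: "x = (\<chi> i. z)"
    by blast
  have "(\<Sum>i\<in>UNIV. c $ i) * z = (\<Sum>i\<in>UNIV. c $ i) * weighted_mean c x0"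
    using assms(1) weighted_mean_mass[of c x0] c_pos by (simp add: z sum_distrib_right)
  moreover have "(\<Sum>i\<in>UNIV. c $ i) > 0"
    using c_pos by (intro sum_pos) auto
  ultimately show False
    using assms(2) z by auto
qed

lemma network_asymptotically_stable:
  "asymptotically_stable_on {x. (\<Sum>i\<in>UNIV. c $ i * x $ i) = (\<Sum>i\<in>UNIV. c $ i * x0 $ i)}
    (network_field B w \<phi>) (\<chi> i. weighted_mean c x0)"
proof -
  define z where "z = weighted_mean c x0"
  define M where "M = {x :: real ^ 'n. (\<Sum>i\<in>UNIV. c $ i * x $ i) = (\<Sum>i\<in>UNIV. c $ i * x0 $ i)}"
  define V where "V x = (\<Sum>i\<in>UNIV. c $ i * (x $ i - z)\<^sup>2)" for x :: "real ^ 'n"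
  \<comment> \<open>Twice the sum in \<open>dissipation_neg\<close> for \<open>g y = y - z\<close>.
    The factor 2 comes from differentiating the square.\<close>
  define W where "W x = 2 * (\<Sum>i\<in>UNIV. (x $ i - z) * (c $ i * network_field B w \<phi> x $ i))" for x
  \<comment> \<open>The smallest weight bounds \<open>V\<close> below by a multiple of the squared
    Euclidean distance.\<close>
  define \<alpha> where "\<alpha> = Min (range (\<lambda>i. c $ i))"
  have "asymptotically_stable_on M (network_field B w \<phi>) (\<chi> i. z)"
  proof (rule strict_lyapunov_imp_asymptotically_stable_on[where V = V and W = W and \<alpha> = \<alpha>])
    show "closed M"
      unfolding M_def by (intro closed_Collect_eq continuous_intros)
    show "(\<chi> i. z) \<in> M"
      using weighted_mean_mass[of c x0] c_pos by (simp add: M_def z_def)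
    show "network_field B w \<phi> (\<chi> i. z) = 0"
      by (rule network_field_consensus)
    show "x t \<in> M" if "solves_on {0..} (network_field B w \<phi>) x" "x 0 \<in> M" "0 \<le> t" for x t
      using mass_invariant[OF that(1,3)] that(2) by (simp add: M_def)
    show "((\<lambda>s. V (x s)) has_real_derivative W (x t)) (at t within {0..})"
      if "solves_on {0..} (network_field B w \<phi>) x" "0 \<le> t" for x t
    proof -
      have "((\<lambda>t. x t $ i) has_real_derivative network_field B w \<phi> (x t) $ i) (at t within {0..})" for i
        using that unfolding solves_on_def has_real_derivative_iff_has_vector_derivative
        by (auto intro: bounded_linear.has_vector_derivative[OF bounded_linear_vec_nth])
      then have "((\<lambda>s. V (x s)) has_real_derivative
          (\<Sum>i\<in>UNIV. c $ i * (2 * (x t $ i - z) * network_field B w \<phi> (x t) $ i))) (at t within {0..})"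
        unfolding V_def by (auto intro!: derivative_eq_intros sum.cong)
      then show ?thesis
        by (simp add: W_def sum_distrib_left algebra_simps)
    qed
    show "continuous_on M V"
      unfolding V_def by (intro continuous_intros)
    show "continuous_on M W"
      unfolding W_def network_field_nth by (intro continuous_intros continuous_on_phi)
    show "V (\<chi> i. z) = 0" "W (\<chi> i. z) = 0"
      by (simp_all add: V_def W_def)
    show "W q < 0" if "q \<in> M" "q \<noteq> (\<chi> i. z)" for q
    proof -
      have "strict_mono (\<lambda>y. y - z)"
        by (simp add: strict_mono_def)
      then show ?thesis
        using dissipation_neg consensus_on_mass that unfolding W_def M_def z_def by fastforce
    qed
    show "0 < \<alpha>"
      using c_pos by (simp add: \<alpha>_def)
    show "\<alpha> * (dist q (\<chi> i. z))\<^sup>2 \<le> V q" for q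
    proof -
      have "(dist q (\<chi> i. z))\<^sup>2 = (\<Sum>i\<in>UNIV. (q $ i - z)\<^sup>2)"
        by (simp add: dist_vec_def L2_set_def dist_real_def sum_nonneg)
      then show ?thesis
        unfolding V_def by (auto simp: sum_distrib_left \<alpha>_def intro!: sum_mono mult_right_mono)
    qed
  qed
  then show ?thesis
    by (simp add: M_def z_def)
qed

end

subsection \<open>The gradient representation\<close>

locale balanced_network_energy = balanced_network B w c \<phi>
  for B :: "('n::finite \<times> 'n) set" and w c \<phi> +
  fixes H h :: "real \<Rightarrow> real"
  assumes H_deriv: "\<And>z. (H has_real_derivative h z) (at z)"
    and H_strictly_convex: "strictly_convex H"
begin

lemma h_strict_mono: "strict_mono h"
  using strictly_convex_deriv_strict_mono H_strictly_convex H_deriv by blast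

lemma gradient_energy: "gradient (energy H c) q = (\<chi> i. h (inverse (c $ i) * q $ i))"
  by (rule gradient_eqI GDERIV_energy c_pos H_deriv)+

lemma energy_differentiable: "energy H c differentiable (at q)"
  using GDERIV_energy[OF c_pos H_deriv] unfolding gderiv_def differentiable_def by blast

lemma flow_quotient_pos: "a \<noteq> b \<Longrightarrow> 0 < flow_quotient \<phi> h a b"
  using phi_neg[of a b] phi_pos[of b a] strict_monoD[OF h_strict_mono, of a b]
    strict_monoD[OF h_strict_mono, of b a]
  by (cases a b rule: linorder_cases) (auto simp: flow_quotient_def divide_neg_neg)

text \<open>On the diagonal the value is a limit of positive quotients, which may vanish.
  Irreducibility of K therefore gets a separate nonvanishing condition.\<close>

lemma flow_quotient_nonneg:
  assumes "flow_quotient_exists \<phi> h a b"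
  shows "0 \<le> flow_quotient \<phi> h a b"
proof (cases "a = b")
  case True
  then obtain l where l: "((\<lambda>s. \<phi> s b / (h s - h b)) \<longlongrightarrow> l) (at b)"
    using assms by (auto simp: flow_quotient_exists_def)
  moreover have "\<forall>\<^sub>F s in at b. 0 \<le> \<phi> s b / (h s - h b)"
    using flow_quotient_pos[of _ b]
    by (auto simp: eventually_at_filter flow_quotient_def intro!: always_eventually less_imp_le)
  ultimately have "0 \<le> l"
    by (auto intro: tendsto_lowerbound)
  then show ?thesis
    using True tendsto_Lim[OF _ l] by (simp add: flow_quotient_def)
qed (use flow_quotient_pos in \<open>simp add: less_imp_le\<close>)

lemma flow_quotient_sym: "flow_quotient \<phi> h a b = flow_quotient \<phi> h b a"
  using minus_divide_divide[of "\<phi> a b" "h a - h b"]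
  by (simp add: flow_quotient_def phi_antisym[of b a] del: minus_divide_divide)

text \<open>Zero row sums turn the product with the gradient into a sum of differences of
  \<open>h\<close>, whose denominators then cancel.\<close>

lemma gradient_field_nth:
  "gradient_field B w c \<phi> H h q $ i =
    c $ i * network_field B w \<phi> (\<chi> i. inverse (c $ i) * q $ i) $ i"
proof -
  define x where "x = (\<chi> i. inverse (c $ i) * q $ i)"
  let ?K = "K_offdiag B w c \<phi> h q i"
  \<comment> \<open>When the two states agree, the factor \<open>h (x $ j) - h (x $ i)\<close> is
    zero and annihilates whatever value \<open>Lim\<close> takes. The representation thus holds at
    every \<open>q\<close>, whether or not the limits exist.\<close>
  have flow: "?K j * (h (x $ j) - h (x $ i)) = - (c $ i * weight B w i j * \<phi> (x $ j) (x $ i))" for j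
    using strict_mono_eq[OF h_strict_mono, of "x $ j" "x $ i"] phi_zero[of "x $ j" "x $ i"]
    by (auto simp: K_offdiag_def flow_quotient_def x_def)
  have "(K_matrix B w c \<phi> h q *v gradient (energy H c) q) $ i
      = (\<Sum>j\<in>UNIV. K_matrix B w c \<phi> h q $ i $ j * h (x $ j))"
    by (simp add: matrix_vector_mult_def gradient_energy x_def)
  also have "\<dots> = K_matrix B w c \<phi> h q $ i $ i * h (x $ i)
      + (\<Sum>j\<in>UNIV - {i}. K_matrix B w c \<phi> h q $ i $ j * h (x $ j))"
    by (rule sum.remove) auto
  also have "\<dots> = (\<Sum>j\<in>UNIV - {i}. ?K j * (h (x $ j) - h (x $ i)))"
    by (simp add: K_matrix_def right_diff_distrib sum_subtractf sum_distrib_right)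
  also have "\<dots> = (\<Sum>j\<in>UNIV. ?K j * (h (x $ j) - h (x $ i)))"
    by (rule sum.mono_neutral_left) auto
  also have "\<dots> = - (c $ i * network_field B w \<phi> x $ i)"
    by (simp add: flow network_field_nth sum_negf sum_distrib_left mult_ac)
  finally show ?thesis
    by (simp add: gradient_field_def x_def)
qed

lemma gradient_field_diag:
  "gradient_field B w c \<phi> H h (diag_matrix c *v x) = diag_matrix c *v network_field B w \<phi> x"
  by (simp add: vec_eq_iff gradient_field_nth mult.assoc[symmetric])

lemma diag_matrix_cancel:
  "diag_matrix c *v (\<chi> i. inverse (c $ i) * q $ i) = q"
  "(\<chi> i. inverse (c $ i) * (diag_matrix c *v x) $ i) = x"
  by (simp_all add: vec_eq_iff mult.assoc[symmetric])

text \<open>\<open>C\<close> and its inverse are bounded linear maps, so derivatives transfer in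
  both directions, and \<open>C\<close> carries one field to the other.\<close>

lemma solves_on_iff:
  "solves_on T (network_field B w \<phi>) x \<longleftrightarrow>
   solves_on T (gradient_field B w c \<phi> H h) (\<lambda>t. diag_matrix c *v x t)"
proof -
  let ?C = "\<lambda>x. diag_matrix c *v x" and ?D = "\<lambda>q. diag_matrix (\<chi> i. inverse (c $ i)) *v q"
  have lin: "bounded_linear ?C" "bounded_linear ?D"
    by (simp_all add: linear_linear)
  have "?D (?C x) = x" for x
    by (simp add: vec_eq_iff mult.assoc[symmetric])
  then have "(x has_vector_derivative y) F \<longleftrightarrow> ((\<lambda>t. ?C (x t)) has_vector_derivative ?C y) F" for y F
    using bounded_linear.has_vector_derivative[OF lin(1), of x y F]
      bounded_linear.has_vector_derivative[OF lin(2), of "\<lambda>t. ?C (x t)" "?C y" F] by auto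
  then show ?thesis
    unfolding solves_on_def gradient_field_diag by blast
qed

section \<open>Structure of the matrix K\<close>

lemma K_offdiag_sym: "K_offdiag B w c \<phi> h q i j = K_offdiag B w c \<phi> h q j i"
  unfolding K_offdiag_def by (subst flow_quotient_sym) (simp add: detailed_balance[of i j])

lemma K_matrix_sym: "transpose (K_matrix B w c \<phi> h q) = K_matrix B w c \<phi> h q"
  by (auto simp: vec_eq_iff transpose_def K_matrix_def K_offdiag_sym)

lemma K_matrix_laplace:
  assumes "\<And>i j. i \<noteq> j \<Longrightarrow> (j, i) \<in> B \<Longrightarrow>
      flow_quotient_exists \<phi> h (inverse (c $ j) * q $ j) (inverse (c $ i) * q $ i)"
  shows "is_laplace_matrix (K_matrix B w c \<phi> h q)"
proof -
  let ?K = "K_offdiag B w c \<phi> h q"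
  \<comment> \<open>The graph is read off from the nonzero entries instead of taking
    \<open>B\<close>: a Laplace matrix requires positive weights, while a limit on the diagonal may
    make the entry of an edge zero.\<close>
  define B' where "B' = {(j, i). i \<noteq> j \<and> ?K i j \<noteq> 0}"
  define w' where "w' = (\<lambda>(j, i). - ?K i j)"
  have "?K i j \<le> 0" if "i \<noteq> j" for i j
  proof (cases "(j, i) \<in> B")
    case True
    then show ?thesis
      using flow_quotient_nonneg[OF assms[OF that True]] c_pos[of i] weight_nonneg[of i j]
      by (simp add: K_offdiag_def)
  qed (simp add: K_offdiag_def weight_def)
  then have "\<forall>e\<in>B'. 0 < w' e"
    by (force simp: B'_def w'_def)
  moreover have weight': "weight B' w' i j = - ?K i j" if "i \<noteq> j" for i j
    using that by (simp add: weight_def B'_def w'_def)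
  have "(\<Sum>k\<in>UNIV - {i}. weight B' w' i k) = - (\<Sum>k\<in>UNIV - {i}. ?K i k)" for i
    using weight' by (simp flip: sum_negf)
  then have "K_matrix B w c \<phi> h q = laplace_matrix B' w'"
    by (simp add: vec_eq_iff K_matrix_def laplace_matrix_def weight')
  ultimately show ?thesis
    unfolding is_laplace_matrix_def by blast
qed

text \<open>An edge from outside \<open>S\<close> into \<open>S\<close> gives a nonzero entry in the
  block. For distinct end states the quotient is positive, so only coinciding ones need the
  hypothesis.\<close>

lemma K_matrix_irreducible:
  assumes "\<And>i j. i \<noteq> j \<Longrightarrow> (j, i) \<in> B \<Longrightarrow> inverse (c $ j) * q $ j = inverse (c $ i) * q $ i \<Longrightarrow>
      flow_quotient \<phi> h (inverse (c $ j) * q $ j) (inverse (c $ i) * q $ i) \<noteq> 0"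
  shows "irreducible_matrix (K_matrix B w c \<phi> h q)"
  unfolding irreducible_matrix_def
proof
  assume "\<exists>S. S \<noteq> {} \<and> S \<noteq> UNIV \<and> (\<forall>i\<in>S. \<forall>j\<in>- S. K_matrix B w c \<phi> h q $ i $ j = 0)"
  then obtain S where S: "S \<noteq> {}" "S \<noteq> UNIV"
    and zero: "\<And>i j. i \<in> S \<Longrightarrow> j \<notin> S \<Longrightarrow> K_matrix B w c \<phi> h q $ i $ j = 0"
    by blast
  obtain i j where ij: "(j, i) \<in> B" "i \<in> S" "j \<notin> S"
    using strongly_connected_crossing_edge[OF connected S] by blast
  then have "i \<noteq> j"
    by blast
  have "flow_quotient \<phi> h (inverse (c $ j) * q $ j) (inverse (c $ i) * q $ i) \<noteq> 0"
    using assms[OF \<open>i \<noteq> j\<close> ij(1)] flow_quotient_pos by (metis less_irrefl)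
  then show False
    using zero[OF ij(2,3)] \<open>i \<noteq> j\<close> ij(1) weights_pos[OF ij(1)]
    by (simp add: K_matrix_def K_offdiag_def weight_def)
qed

text \<open>Everything is pulled back to \<open>x\<close> by inverting \<open>C\<close>: invariance
  is conservation of mass, the strict minimum is \<open>energy_strict_min\<close>, and decay is
  \<open>dissipation_neg\<close> with \<open>g = h\<close>.\<close>

lemma energy_lyapunov:
  "lyapunov_function_on {q. (\<Sum>i\<in>UNIV. q $ i) = (\<Sum>i\<in>UNIV. c $ i * x0 $ i)}
    (gradient_field B w c \<phi> H h) (diag_matrix c *v (\<chi> i. weighted_mean c x0)) (energy H c)"
  unfolding lyapunov_function_on_def mem_Collect_eq
proof (intro conjI allI ballI impI; (elim conjE)?)
  let ?m = "\<Sum>i\<in>UNIV. c $ i * x0 $ i" and ?z = "weighted_mean c x0"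
  let ?p = "diag_matrix c *v (\<chi> i. ?z)"
  show "(\<Sum>i\<in>UNIV. ?p $ i) = ?m"
    by (simp add: weighted_mean_mass[OF c_pos])
  show "gradient_field B w c \<phi> H h ?p = 0"
    by (simp add: gradient_field_diag network_field_consensus)
  show "energy H c differentiable (at q)" for q
    by (rule energy_differentiable)
  show "(\<Sum>i\<in>UNIV. y t $ i) = ?m"
    if "solves_on {0..} (gradient_field B w c \<phi> H h) y" "(\<Sum>i\<in>UNIV. y 0 $ i) = ?m" "0 \<le> t" for y t
  proof -
    define x where "x t = (\<chi> i. inverse (c $ i) * y t $ i)" for t
    have "solves_on {0..} (network_field B w \<phi>) x"
      unfolding solves_on_iff x_def diag_matrix_cancel using that(1) .
    then have "(\<Sum>i\<in>UNIV. c $ i * x t $ i) = (\<Sum>i\<in>UNIV. c $ i * x 0 $ i)"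
      using \<open>0 \<le> t\<close> by (rule mass_invariant)
    then show ?thesis
      using that(2) by (simp add: x_def mult.assoc[symmetric])
  qed
  fix q :: "real ^ 'n"
  assume "q \<in> {q. (\<Sum>i\<in>UNIV. q $ i) = ?m}" and ne: "q \<noteq> ?p"
  define x where "x = (\<chi> i. inverse (c $ i) * q $ i)"
  have q: "q = diag_matrix c *v x"
    unfolding x_def diag_matrix_cancel ..
  have mass: "(\<Sum>i\<in>UNIV. c $ i * x $ i) = ?m"
    using \<open>q \<in> _\<close> by (simp add: q)
  have x_ne: "x \<noteq> (\<chi> i. ?z)"
    using ne by (auto simp: q)
  show "energy H c ?p < energy H c q"
    unfolding q using mass weighted_mean_mass[of c x0] c_pos x_ne
    by (intro energy_strict_min[OF _ H_strictly_convex H_deriv]) auto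
  have "gradient (energy H c) q \<bullet> gradient_field B w c \<phi> H h q
      = (\<Sum>i\<in>UNIV. h (x $ i) * (c $ i * network_field B w \<phi> x $ i))"
    by (simp add: inner_vec_def gradient_energy gradient_field_nth x_def)
  also have "\<dots> < 0"
    using h_strict_mono consensus_on_mass[OF mass x_ne] by (rule dissipation_neg)
  finally show "gradient (energy H c) q \<bullet> gradient_field B w c \<phi> H h q < 0" .
qed

end

theorem theorem1:
  fixes B :: "('n::finite \<times> 'n) set"
    and w :: "'n \<times> 'n \<Rightarrow> real"
    and c :: "real ^ 'n"
    and \<phi> :: "real \<Rightarrow> real \<Rightarrow> real"
    and H h :: "real \<Rightarrow> real"
  assumes weights_pos: "\<And>e. e \<in> B \<Longrightarrow> 0 < w e"
    and connected: "strongly_connected B"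
    and c_pos: "\<And>i. 0 < c $ i"
    and detailed_balance: "\<And>i j. c $ i * weight B w i j = c $ j * weight B w j i"
    and phi_lipschitz: "\<exists>L. L-lipschitz_on UNIV (\<lambda>(a, b). \<phi> a b)"
    and phi_neg: "\<And>a b. a < b \<Longrightarrow> \<phi> a b < 0"
    and phi_zero: "\<And>a b. \<phi> a b = 0 \<longleftrightarrow> a = b"
    and phi_pos: "\<And>a b. a > b \<Longrightarrow> \<phi> a b > 0"
    and phi_increasing: "\<And>a b a' b'. \<bar>a - b\<bar> < \<bar>a' - b'\<bar> \<Longrightarrow> \<bar>\<phi> a b\<bar> < \<bar>\<phi> a' b'\<bar>"
    and H_deriv: "\<And>z. (H has_real_derivative h z) (at z)"
    and h_C1: "h C1_differentiable_on UNIV"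
    and H_strictly_convex: "strictly_convex H"
  shows
    \<comment> \<open>gradient representation in the state \<open>q = C x\<close>\<close>
    "(\<forall>q. energy H c differentiable (at q)) \<and>
     (\<forall>T x. is_interval T \<longrightarrow>
        solves_on T (network_field B w \<phi>) x \<longleftrightarrow>
        solves_on T (gradient_field B w c \<phi> H h) (\<lambda>t. diag_matrix c *v x t)) \<and>
     \<comment> \<open>\<open>K(q)\<close> is a symmetric Laplace matrix wherever the limits in its definition exist,
       and irreducible if these limits are nonzero\<close>
     (\<forall>q. let x = (\<chi> i. inverse (c $ i) * q $ i) in
        (\<forall>i j. i \<noteq> j \<and> (j, i) \<in> B \<longrightarrow> flow_quotient_exists \<phi> h (x $ j) (x $ i)) \<longrightarrow>
          is_laplace_matrix (K_matrix B w c \<phi> h q) \<and>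
          transpose (K_matrix B w c \<phi> h q) = K_matrix B w c \<phi> h q \<and>
          ((\<forall>i j. i \<noteq> j \<and> (j, i) \<in> B \<and> x $ j = x $ i \<longrightarrow> flow_quotient \<phi> h (x $ j) (x $ i) \<noteq> 0) \<longrightarrow>
             irreducible_matrix (K_matrix B w c \<phi> h q))) \<and>
     \<comment> \<open>Lyapunov function and asymptotic stability for every initial state \<open>x0\<close>\<close>
     (\<forall>x0. let x_inf = (\<chi> i. weighted_mean c x0);
               m = (\<Sum>i\<in>UNIV. c $ i * x0 $ i) in
        lyapunov_function_on {q. (\<Sum>i\<in>UNIV. q $ i) = m}
          (gradient_field B w c \<phi> H h) (diag_matrix c *v x_inf) (energy H c) \<and>
        asymptotically_stable_on {x. (\<Sum>i\<in>UNIV. c $ i * x $ i) = m}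
          (network_field B w \<phi>) x_inf)"
proof -
  \<comment> \<open>Lipschitz continuity supplies the joint continuity of \<phi> that the locale
    assumes.\<close>
  have "continuous_on UNIV (\<lambda>(a, b). \<phi> a b)"
    using phi_lipschitz lipschitz_on_continuous_on by blast
  then interpret balanced_network_energy B w c \<phi> H h
    using assms by unfold_locales auto
  show ?thesis
    unfolding Let_def vec_lambda_beta
    using energy_differentiable solves_on_iff K_matrix_laplace K_matrix_sym K_matrix_irreducible
      energy_lyapunov network_asymptotically_stable
    by (intro conjI allI impI) blast+
qed

end
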